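(* There is no social reputation rule for positive reputation system settings that satisfies all three of the postulates Weak Generality (WG), Transitivity (T) and Very Weak Monotonicity (VWM).
   Context: A positive reputation system setting is a finite directed graph $G=(V,E)$ without self-loops, where $V$ is the set of agents and $E\subseteq V^2$ is the set of positive feedbacks ($(u,v)\in E$ means that $u$ gives positive feedback on $v$). For $v\in V$ let $R(v)=\{u\in V:(u,v)\in E\}$. The setting is strongly connected if for every pair of distinct nodes $v,t\in V$ there is a directed path from $v$ to $t$. A social ranking of $G$ is a function $S(G):V\to\{1,\dots,|V|\}$ (not necessarily injective). Write $v_i\ge v_j$ if $S(G)(v_i)\le S(G)(v_j)$ (so a smaller number means ranked higher), and $v_i>v_j$ if $v_i\ge v_j$ but not $v_j\ge v_i$. As usual $v\le w$ means $w\ge v$, and $v<w$ means $w>v$. A social reputation rule $S$ assigns to each positive reputation system setting $G$ in some nonempty class of settings (its domain) a social ranking $S(G)$ of the nodes of $G$. Given $G$ and $S(G)$, $R(v_i)$ is more important than $R(v_j)$ if there is an injective map $f:R(v_j)\to R(v_i)$ such that $v\le f(v)$ for every $v\in R(v_j)$, and either $f$ is not onto or there is at least one $v\in R(v_j)$ with $v<f(v)$. Postulates for a rule $S$: - Weak Generality (WG): $S$ is defined on every strongly connected positive reputation system setting. - Transitivity (T): for every $G=(V,E)$ in the domain of $S$, with respect to $S(G)$: for all $v_i,v_j\in V$, if $R(v_i)$ is more important than $R(v_j)$ then $v_i>v_j$. - Very Weak Monotonicity (VWM): for every $G=(V,E)$ in the domain of $S$, with respect to $S(G)$: for all $v_i,v_j\in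 V$ with $v_i>v_j$, if $R(v_i)$ is not more important than $R(v_j)$ and $|R(v_i)|\le |R(v_j)|+1$, then there exist $v_1\in R(v_i)$ and $v_2\in R(v_j)$ such that $v_1>v_2$. *)

theory Defs
  imports "Graph_Theory.Digraph_Component" "Graph_Theory.Pair_Digraph"
begin

(* pair_digraph: finite vertex and arc sets, arcs between vertices, no loops. *)
abbreviation reputation_setting :: "'a pair_pre_digraph \<Rightarrow> bool" where
  "reputation_setting G \<equiv> pair_digraph G"

definition raters :: "'a pair_pre_digraph \<Rightarrow> 'a \<Rightarrow> 'a set" where
  "raters G v = {u \<in> pverts G. (u, v) \<in> parcs G}"

(* Only the values of r on the agents of G are constrained or ever used. *)
definition social_ranking :: "'a pair_pre_digraph \<Rightarrow> ('a \<Rightarrow> nat) \<Rightarrow> bool" where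
  "social_ranking G r \<longleftrightarrow> (\<forall>v \<in> pverts G. r v \<in> {1..card (pverts G)})"

(* ranked_ge r v w is v \<ge> w and ranked_gt r v w is v > w; a smaller number is a higher rank. *)
definition ranked_ge :: "('a \<Rightarrow> nat) \<Rightarrow> 'a \<Rightarrow> 'a \<Rightarrow> bool" where
  "ranked_ge r v w \<longleftrightarrow> r v \<le> r w"

definition ranked_gt :: "('a \<Rightarrow> nat) \<Rightarrow> 'a \<Rightarrow> 'a \<Rightarrow> bool" where
  "ranked_gt r v w \<longleftrightarrow> ranked_ge r v w \<and> \<not> ranked_ge r w v"

definition more_important :: "('a \<Rightarrow> nat) \<Rightarrow> 'a set \<Rightarrow> 'a set \<Rightarrow> bool" where
  "more_important r A B \<longleftrightarrow>
     (\<exists>f. inj_on f B \<and> f ` B \<subseteq> A \<and> (\<forall>v \<in> B. ranked_ge r (f v) v) \<and>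
          (f ` B \<noteq> A \<or> (\<exists>v \<in> B. ranked_gt r (f v) v)))"

(* A rule is a partial function; its domain is the class of settings it ranks. *)
type_synonym 'a rule = "'a pair_pre_digraph \<Rightarrow> ('a \<Rightarrow> nat) option"

definition social_reputation_rule :: "'a rule \<Rightarrow> bool" where
  "social_reputation_rule S \<longleftrightarrow>
     dom S \<noteq> {} \<and> (\<forall>G r. S G = Some r \<longrightarrow> reputation_setting G \<and> social_ranking G r)"

definition weak_generality :: "'a rule \<Rightarrow> bool" where
  "weak_generality S \<longleftrightarrow>
     (\<forall>G. reputation_setting G \<and> strongly_connected (with_proj G) \<longrightarrow> G \<in> dom S)"

definition transitivity :: "'a rule \<Rightarrow> bool" where
  "transitivity S \<longleftrightarrow>
     (\<forall>G r. S G = Some r \<longrightarrow>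
       (\<forall>v \<in> pverts G. \<forall>w \<in> pverts G.
          more_important r (raters G v) (raters G w) \<longrightarrow> ranked_gt r v w))"

definition very_weak_monotonicity :: "'a rule \<Rightarrow> bool" where
  "very_weak_monotonicity S \<longleftrightarrow>
     (\<forall>G r. S G = Some r \<longrightarrow>
       (\<forall>v \<in> pverts G. \<forall>w \<in> pverts G.
          ranked_gt r v w \<and> \<not> more_important r (raters G v) (raters G w) \<and>
          card (raters G v) \<le> card (raters G w) + 1 \<longrightarrow>
          (\<exists>x \<in> raters G v. \<exists>y \<in> raters G w. ranked_gt r x y)))"

end

theory Submission
  imports Defs
begin

text \<open>
  The rule fails on a single setting with five agents and arcs
  \<open>a \<rightarrow> v\<close>, \<open>b \<rightarrow> v\<close>, \<open>v \<rightarrow> y\<close>, \<open>y \<rightarrow> w\<close>, \<open>w \<rightarrow> a\<close>, \<open>w \<rightarrow> b\<close>. Agents with one rater each are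
  ranked as their raters are, so \<open>a\<close> and \<open>b\<close> compare to \<open>y\<close> as \<open>w\<close> compares to \<open>v\<close>. If \<open>v > w\<close>,
  then \<open>y\<close> beats both \<open>a\<close> and \<open>b\<close>, and VWM forbids \<open>v > w\<close>. If \<open>v \<le> w\<close>, then \<open>a \<ge> y\<close>, so \<open>{a, b}\<close> is
  more important than \<open>{y}\<close> and T forces \<open>v > w\<close>.
\<close>

lemma ranked_gt_iff: "ranked_gt r v w \<longleftrightarrow> r v < r w"
  by (auto simp: ranked_gt_def ranked_ge_def)

text \<open>An injection from a singleton is the choice of one image \<open>x\<close>, and it fails
  to be onto exactly when \<open>A\<close> is not \<open>{x}\<close>.\<close>

lemma more_important_singleton_right:
  "more_important r A {y} \<longleftrightarrow> (\<exists>x\<in>A. r x \<le> r y \<and> (A \<noteq> {x} \<or> r x < r y))"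
proof
  assume "more_important r A {y}"
  then show "\<exists>x\<in>A. r x \<le> r y \<and> (A \<noteq> {x} \<or> r x < r y)"
    unfolding more_important_def by (auto simp: ranked_ge_def ranked_gt_iff)
next
  assume "\<exists>x\<in>A. r x \<le> r y \<and> (A \<noteq> {x} \<or> r x < r y)"
  then obtain x where "x \<in> A" "r x \<le> r y" "A \<noteq> {x} \<or> r x < r y"
    by blast
  then show "more_important r A {y}"
    unfolding more_important_def
    by (intro exI[of _ "\<lambda>_. x"]) (auto simp: ranked_ge_def ranked_gt_iff)
qed

text \<open>T carries the order from the raters to the agents. Conversely, the rater sets have equal
  size, so if \<open>s\<close> did not beat \<open>t\<close>, VWM would apply, yet its only possible
  witnesses are \<open>s\<close> and \<open>t\<close>.\<close>

lemma ranked_gt_single_rater_iff: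
  assumes "transitivity S" "very_weak_monotonicity S" "S G = Some r"
    and "p \<in> pverts G" "q \<in> pverts G" "raters G p = {s}" "raters G q = {t}"
  shows "r p < r q \<longleftrightarrow> r s < r t"
proof
  assume "r s < r t"
  then have "more_important r (raters G p) (raters G q)"
    using assms by (simp add: more_important_singleton_right)
  then show "r p < r q"
    using assms unfolding transitivity_def ranked_gt_iff by blast
next
  assume pq: "r p < r q"
  show "r s < r t"
  proof (rule ccontr)
    assume n: "\<not> r s < r t"
    then have "\<not> more_important r (raters G p) (raters G q)"
      using assms by (simp add: more_important_singleton_right)
    moreover have "card (raters G p) \<le> card (raters G q) + 1"
      using assms by simp
    ultimately have "\<exists>x\<in>raters G p. \<exists>z\<in>raters G q. r x < r z"
      using assms pq unfolding very_weak_monotonicity_def ranked_gt_iff by blast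
    with n show False
      using assms by simp
  qed
qed

definition paradox_setting :: "'a \<Rightarrow> 'a \<Rightarrow> 'a \<Rightarrow> 'a \<Rightarrow> 'a \<Rightarrow> 'a pair_pre_digraph" where
  "paradox_setting v w a b y =
     \<lparr>pverts = {v, w, a, b, y}, parcs = {(a, v), (b, v), (v, y), (y, w), (w, a), (w, b)}\<rparr>"

lemma reputation_setting_paradox:
  assumes "distinct [v, w, a, b, y]"
  shows "reputation_setting (paradox_setting v w a b y)"
  using assms by unfold_locales (auto simp: paradox_setting_def)

text \<open>Two 4-cycles share the path from \<open>v\<close> through \<open>y\<close> to
  \<open>w\<close>, so any two agents are joined through \<open>v\<close>.\<close>

lemma strongly_connected_paradox:
  assumes "distinct [v, w, a, b, y]"
  shows "strongly_connected (with_proj (paradox_setting v w a b y))"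
proof -
  let ?G = "paradox_setting v w a b y"
  interpret pair_digraph ?G
    by (rule reputation_setting_paradox[OF assms])
  have arcs: "(a, v) \<in> parcs ?G" "(b, v) \<in> parcs ?G" "(v, y) \<in> parcs ?G"
      "(y, w) \<in> parcs ?G" "(w, a) \<in> parcs ?G" "(w, b) \<in> parcs ?G"
    by (simp_all add: paradox_setting_def)
  note reach = arcs[THEN reachable_adjI]
  have wv: "w \<rightarrow>\<^sup>*\<^bsub>?G\<^esub> v" and vw: "v \<rightarrow>\<^sup>*\<^bsub>?G\<^esub> w"
    by (rule reachable_trans[OF reach(5) reach(1)], rule reachable_trans[OF reach(3) reach(4)])
  have to_v: "u \<rightarrow>\<^sup>*\<^bsub>?G\<^esub> v" if "u \<in> pverts ?G" for u
    using that wv reach(1,2) reachable_trans[OF reach(4) wv] reachable_trans[OF vw wv]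
    by (auto simp: paradox_setting_def)
  have from_v: "v \<rightarrow>\<^sup>*\<^bsub>?G\<^esub> u" if "u \<in> pverts ?G" for u
    using that vw reach(3) reachable_trans[OF vw reach(5)] reachable_trans[OF vw reach(6)]
      reachable_trans[OF vw wv]
    by (auto simp: paradox_setting_def)
  have "u \<rightarrow>\<^sup>*\<^bsub>?G\<^esub> u'" if "u \<in> pverts ?G" "u' \<in> pverts ?G" for u u'
    using to_v[OF that(1)] from_v[OF that(2)] by (rule reachable_trans)
  then show ?thesis
    by (simp add: strongly_connected_def) (simp add: paradox_setting_def)
qed

lemma raters_paradox:
  assumes "distinct [v, w, a, b, y]"
  shows "raters (paradox_setting v w a b y) v = {a, b}"
    and "raters (paradox_setting v w a b y) w = {y}"
    and "raters (paradox_setting v w a b y) a = {w}"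
    and "raters (paradox_setting v w a b y) b = {w}"
    and "raters (paradox_setting v w a b y) y = {v}"
  using assms by (auto simp: raters_def paradox_setting_def)

lemma paradox:
  assumes dist: "distinct [v, w, a, b, y]"
    and T: "transitivity S" and VWM: "very_weak_monotonicity S"
    and r: "S (paradox_setting v w a b y) = Some r"
  shows False
proof -
  let ?G = "paradox_setting v w a b y"
  note raters = raters_paradox[OF dist]
  have verts: "v \<in> pverts ?G" "w \<in> pverts ?G" "a \<in> pverts ?G" "b \<in> pverts ?G" "y \<in> pverts ?G"
    by (simp_all add: paradox_setting_def)
  note single = ranked_gt_single_rater_iff[OF T VWM r]
  have ya: "r y < r a \<longleftrightarrow> r v < r w" and yb: "r y < r b \<longleftrightarrow> r v < r w"
    using single verts raters by blast+
  show False
  proof (cases "r v < r w")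
    case True
    with ya yb have low: "r y < r a" "r y < r b"
      by simp_all
    \<comment> \<open>The image of \<open>y\<close> would have to be \<open>a\<close> or
      \<open>b\<close>, and both rank strictly below \<open>y\<close>.\<close>
    then have "\<not> more_important r (raters ?G v) (raters ?G w)"
      using raters by (simp add: more_important_singleton_right)
    \<comment> \<open>The sizes 2 and 1 meet the bound of VWM with equality.\<close>
    moreover have "card (raters ?G v) \<le> card (raters ?G w) + 1"
      using dist raters by simp
    ultimately have "\<exists>x\<in>raters ?G v. \<exists>z\<in>raters ?G w. r x < r z"
      using VWM r verts True unfolding very_weak_monotonicity_def ranked_gt_iff by blast
    with low show False
      using raters by auto
  next
    case False
    with ya have "r a \<le> r y"
      by simp
    \<comment> \<open>Sending \<open>y\<close> to \<open>a\<close> misses \<open>b\<close>, so even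
      a tie between \<open>a\<close> and \<open>y\<close> is enough.\<close>
    moreover have "{a, b} \<noteq> {a}"
      using dist by auto
    ultimately have "more_important r (raters ?G v) (raters ?G w)"
      using raters by (simp add: more_important_singleton_right)
    with False show False
      using T r verts unfolding transitivity_def ranked_gt_iff by blast
  qed
qed

theorem theorem5:
  assumes "infinite (UNIV :: 'a set)"
  shows "\<not> (\<exists>S :: 'a rule. social_reputation_rule S \<and>
           weak_generality S \<and> transitivity S \<and> very_weak_monotonicity S)"
proof
  assume "\<exists>S :: 'a rule. social_reputation_rule S \<and>
           weak_generality S \<and> transitivity S \<and> very_weak_monotonicity S"
  then obtain S :: "'a rule" where WG: "weak_generality S"
    and T: "transitivity S" and VWM: "very_weak_monotonicity S"
    by blast
  \<comment> \<open>The infinite type supplies the five distinct agents that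
    \<open>paradox_setting\<close> takes as parameters.\<close>
  obtain A :: "'a set" where A: "finite A" "card A = 5"
    using infinite_arbitrarily_large[OF assms] by blast
  obtain xs where "set xs = A" "distinct xs"
    using finite_distinct_list[OF A(1)] by blast
  moreover from this have "length xs = 5"
    using A(2) distinct_card[of xs] by simp
  ultimately obtain v w a b y where dist: "distinct [v, w, a, b, y :: 'a]"
    by (auto simp: eval_nat_numeral length_Suc_conv)
  have "paradox_setting v w a b y \<in> dom S"
    using WG reputation_setting_paradox[OF dist] strongly_connected_paradox[OF dist]
    unfolding weak_generality_def by blast
  then show False
    using paradox[OF dist T VWM] by blast
qed

end
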